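(* Let $n,k\ge 1$ be integers, let $\mathbb F$ be a field, and let $X=(x_{i\,j})$ be an $n\times k$ matrix whose entries are the indeterminates $x_{1\,1},\ldots,x_{n\,k}$ over $\mathbb F$. Suppose $n\ge k$. Then the following equality holds in $\mathbb F[x_{1\,1},\ldots,x_{n\,k}]$: \[ \det_{n\,k}(X)=\begin{cases} (-1)^{1+2+\cdots+k}\,\mathrm{pf}\left(X^t\mathbf D^{(n)}X\right), & k \text{ even},\\ (-1)^{1+2+\cdots+(k+1)}\,\mathrm{pf}\left((X')^t\mathbf D^{(n)}X'\right), & k \text{ odd},\ n\text{ even},\\ (-1)^{1+2+\cdots+(k+1)}\,\mathrm{pf}\left((X'')^t\mathbf D^{(n+1)}X''\right), & k \text{ odd},\ n\text{ odd}, \end{cases} \] where $X'$ is the $n\times(k+1)$ matrix obtained from $X$ by appending a last column all of whose entries equal $1$, and $X''$ is the $(n+1)\times(k+1)$ matrix obtained from $X'$ by appending a last row $(0,\ldots,0,1)$. If instead $n<k$, then the same equality (with the roles of $n$ and $k$ interchanged) holds for $\det_{k\,n}(X^t)$, which by definition equals $\det_{n\,k}(X)$.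
   Context: For a tuple $(c_1,\ldots,c_n)$ of natural numbers ($n\ge2$), $\mathrm{sgn}(c_1,\ldots,c_n)=0$ if $c_i=c_j$ for some $i<j$, and otherwise $\mathrm{sgn}(c_1,\ldots,c_n)=(-1)^{|\{(i,j):1\le i<j\le n,\ c_i>c_j\}|}$. The matrix $\mathbf D^{(n)}=(d^{(n)}_{i\,j})$ is the $n\times n$ matrix with $d^{(n)}_{i\,j}=(-1)^{i+j}\mathrm{sgn}(i,j)$ for $1\le i,j\le n$ (entries interpreted in $\mathbb F$). Cullis' determinant: for $n\ge k\ge1$ and an $n\times k$ matrix $X=(x_{i\,j})$, \[\det_{n\,k}(X)=(-1)^{1+\cdots+k}\sum_{1\le c_1<\cdots<c_k\le n}(-1)^{c_1+\cdots+c_k}\det\bigl(x_{c_a\,b}\bigr)_{1\le a,b\le k},\] and for $k>n$, $\det_{n\,k}(X)=\det_{k\,n}(X^t)$. Pfaffian: $\Pi_{2m}\subseteq S_{2m}$ is the set of permutations $\pi$ with $\pi(1)<\pi(3)<\cdots<\pi(2m-1)$ and $\pi(2l-1)<\pi(2l)$ for all $1\le l\le m$; for a skew-symmetric $2m\times 2m$ matrix $Y=(y_{i\,j})$, $\mathrm{pf}(Y)=\sum_{\pi\in\Pi_{2m}}\mathrm{sgn}(\pi)\prod_{l=1}^m y_{\pi(2l-1)\,\pi(2l)}$, where $\mathrm{sgn}(\pi)$ is the sign of the permutation. *)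

theory Defs
  imports
    "HOL-Library.Poly_Mapping"
    "Jordan_Normal_Form.Determinant"
begin

text \<open>
  Matrices are those of \<^theory>\<open>Jordan_Normal_Form.Matrix\<close>, whose entries are indexed from 0.
  Row and column numbers in signs, in column/row tuples, in permutations and in the names of
  the indeterminates are counted from 1, so the entry in row \<open>i\<close> and column \<open>j\<close>
  of \<open>X\<close> is \<open>X $$ (i - 1, j - 1)\<close>.
\<close>

definition tuple_sgn :: "nat list \<Rightarrow> int" where
  "tuple_sgn c = (if distinct c
     then (-1) ^ card {(i, j). i < j \<and> j < length c \<and> c ! i > c ! j}
     else 0)"

definition D_mat :: "nat \<Rightarrow> 'a::comm_ring_1 mat" where
  "D_mat n = mat n n (\<lambda>(i, j).
     of_int ((-1) ^ ((i + 1) + (j + 1)) * tuple_sgn [i + 1, j + 1]))"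

definition increasing_tuples :: "nat \<Rightarrow> nat \<Rightarrow> nat list set" where
  "increasing_tuples n k = {c. length c = k \<and> sorted_wrt (<) c \<and> set c \<subseteq> {1..n}}"

definition cullis_det_tall :: "'a::comm_ring_1 mat \<Rightarrow> 'a" where
  "cullis_det_tall X =
     (let n = dim_row X; k = dim_col X in
      (-1) ^ (\<Sum>{1..k}) *
      (\<Sum>c \<in> increasing_tuples n k.
         (-1) ^ sum_list c * det (mat k k (\<lambda>(a, b). X $$ (c ! a - 1, b)))))"

definition cullis_det :: "'a::comm_ring_1 mat \<Rightarrow> 'a" where
  "cullis_det X =
     (if dim_row X \<ge> dim_col X then cullis_det_tall X else cullis_det_tall (X\<^sup>T))"

definition pf_perms :: "nat \<Rightarrow> (nat \<Rightarrow> nat) set" where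
  "pf_perms m = {\<pi>. \<pi> permutes {1..2 * m} \<and>
     (\<forall>l \<in> {1..<m}. \<pi> (2 * l - 1) < \<pi> (2 * l + 1)) \<and>
     (\<forall>l \<in> {1..m}. \<pi> (2 * l - 1) < \<pi> (2 * l))}"

text \<open>Only meaningful for skew-symmetric matrices of even size.\<close>

definition pfaffian :: "'a::comm_ring_1 mat \<Rightarrow> 'a" where
  "pfaffian Y =
     (let m = dim_row Y div 2 in
      \<Sum>\<pi> \<in> pf_perms m. of_int (sign \<pi>) *
        (\<Prod>l = 1..m. Y $$ (\<pi> (2 * l - 1) - 1, \<pi> (2 * l) - 1)))"

definition append_ones_col :: "'a::comm_ring_1 mat \<Rightarrow> 'a mat" where
  "append_ones_col X = mat (dim_row X) (dim_col X + 1)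
     (\<lambda>(i, j). if j < dim_col X then X $$ (i, j) else 1)"

definition append_unit_row :: "'a::comm_ring_1 mat \<Rightarrow> 'a mat" where
  "append_unit_row X = mat (dim_row X + 1) (dim_col X)
     (\<lambda>(i, j). if i < dim_row X then X $$ (i, j)
        else if j = dim_col X - 1 then 1 else 0)"

text \<open>
  Polynomials over \<open>'a\<close> in indeterminates indexed by \<open>'v\<close>: finitely supported maps from
  monomials (finitely supported exponent functions) to coefficients, with convolution product.
\<close>

type_synonym ('v, 'a) polys = "('v \<Rightarrow>\<^sub>0 nat) \<Rightarrow>\<^sub>0 'a"

definition indet :: "'v \<Rightarrow> ('v, 'a::comm_ring_1) polys" where
  "indet v = Poly_Mapping.single (Poly_Mapping.single v 1) 1"

definition indet_mat :: "nat \<Rightarrow> nat \<Rightarrow> (nat \<times> nat, 'a::comm_ring_1) polys mat" where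
  "indet_mat n k = mat n k (\<lambda>(i, j). indet (i + 1, j + 1))"

text \<open>The matrices to which \<^const>\<open>pfaffian\<close> is applied are indeed skew-symmetric.\<close>

lemma D_mat_carrier: "D_mat n \<in> carrier_mat n n"
  by (simp add: D_mat_def)

lemma tuple_sgn_pair: "tuple_sgn [a, b] = (if a = b then 0 else if a < b then 1 else -1)"
proof -
  have "{(i, j). i < j \<and> j < length [a, b] \<and> [a, b] ! i > [a, b] ! j} =
      (if b < a then {(0, 1)} else {})"
    by (auto simp: less_Suc_eq)
  then show ?thesis
    unfolding tuple_sgn_def by (simp del: list.size)
qed

lemma transpose_D_mat: "(D_mat n)\<^sup>T = - (D_mat n :: 'a::comm_ring_1 mat)"
  by (rule eq_matI) (auto simp: D_mat_def tuple_sgn_pair add.commute)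

lemma skew_symmetric_congruence:
  fixes A :: "'a::comm_ring_1 mat"
  assumes A: "A \<in> carrier_mat n k"
  shows "(A\<^sup>T * D_mat n * A)\<^sup>T = - (A\<^sup>T * D_mat n * A)"
proof -
  let ?D = "D_mat n :: 'a mat"
  have D: "?D \<in> carrier_mat n n" by (rule D_mat_carrier)
  have AT: "A\<^sup>T \<in> carrier_mat k n" using A by simp
  have ATD: "A\<^sup>T * ?D \<in> carrier_mat k n" using AT D by simp
  have "(A\<^sup>T * ?D * A)\<^sup>T = A\<^sup>T * (?D\<^sup>T * A)"
    using transpose_mult[OF ATD A] transpose_mult[OF AT D] by simp
  also have "\<dots> = A\<^sup>T * (- (?D * A))"
    using D A by (simp add: transpose_D_mat)
  also have "\<dots> = - (A\<^sup>T * (?D * A))"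
    using A D by simp
  also have "\<dots> = - (A\<^sup>T * ?D * A)"
    using assoc_mult_mat[OF AT D A] by simp
  finally show ?thesis .
qed

end

theory Submission
  imports Defs "HOL-Combinatorics.Multiset_Permutations"
begin

text \<open>
  Both sides are expanded over tuples \<open>g\<close> of rows, \<open>g\<close> assigning a row to each column. Expanding
  \<open>pf (X\<^sup>t D X)\<close> multilinearly in the columns of \<open>X\<close>, the coefficient of \<open>\<Prod>\<^sub>b x\<^bsub>g\<^sub>b b\<^esub>\<close> is the
  Pfaffian of the matrix \<open>(d\<^bsub>g\<^sub>a g\<^sub>b\<^esub>)\<close>, which equals \<open>(-1)\<^bsup>\<Sum>g\<^esup> sgn g\<close>; the same coefficient arises
  when each minor in Cullis' determinant is expanded. The evaluation of the Pfaffian uses the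
  expansion along the first row and, for \<open>A\<close> of odd size, the identity
  \<open>\<Sum>\<^bsub>x \<in> A\<^esub> sgn(a,x) \<Prod>\<^bsub>y \<in> A - {x}\<^esub> sgn(x,y) = \<Prod>\<^bsub>x \<in> A\<^esub> sgn(a,x)\<close>.

  For odd \<open>k\<close> and even \<open>n\<close>, appending a column of ones does not change the sum over row tuples,
  because \<open>\<Sum>\<^sub>a (-1)\<^sup>a sgn(g,a) = sgn g\<close> over \<open>a = 1,\<dots>,n\<close>. For odd \<open>n\<close> a zero row is added first,
  which does not change the sum either.
\<close>

section \<open>Expansion of the Pfaffian along the first row\<close>

definition delete_nth :: "nat \<Rightarrow> 'a list \<Rightarrow> 'a list" where
  "delete_nth i xs = take i xs @ drop (Suc i) xs"

lemma length_delete_nth: "i < length xs \<Longrightarrow> length (delete_nth i xs) = length xs - 1"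
  by (simp add: delete_nth_def)

lemma nth_delete_nth:
  "j < length xs \<Longrightarrow> i < length xs - 1 \<Longrightarrow> delete_nth j xs ! i = xs ! insert_index j i"
  by (auto simp: delete_nth_def insert_index_def nth_append min_def)

text \<open>Lists of odd length get the value 0.\<close>

function pf_list :: "('b \<Rightarrow> 'b \<Rightarrow> 'a::comm_ring_1) \<Rightarrow> 'b list \<Rightarrow> 'a" where
  "pf_list Y [] = 1"
| "pf_list Y (a # xs) =
     (\<Sum>i<length xs. (-1) ^ i * Y a (xs ! i) * pf_list Y (delete_nth i xs))"
  by pat_completeness auto
termination
  by (relation "measure (\<lambda>(Y, xs). length xs)") (auto simp: length_delete_nth)

text \<open>The permutations of \<^const>\<open>pf_perms\<close>, shifted to act on \<open>{0..<2 * m}\<close>.\<close>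

definition pf_perms0 :: "nat \<Rightarrow> (nat \<Rightarrow> nat) set" where
  "pf_perms0 m = {p. p permutes {0..<2 * m} \<and>
     (\<forall>l. Suc l < m \<longrightarrow> p (2 * l) < p (2 * l + 2)) \<and>
     (\<forall>l<m. p (2 * l) < p (2 * l + 1))}"

text \<open>\<open>insert_index j\<close> is the increasing map that skips the value j, so insertion
  at position 0 puts j in front and renumbers the values of p around it.\<close>

lemma permutation_insert_0: 
  "permutation_insert 0 j p i = (case i of 0 \<Rightarrow> j | Suc i' \<Rightarrow> insert_index j (p i'))"
  by (auto simp: permutation_insert_expand insert_index_def split: nat.split)

lemma insert_index_less_iff [simp]: "insert_index j a < insert_index j b \<longleftrightarrow> a < b"
  by (auto simp: insert_index_def)

text \<open>With both parameters 0 the insertion fixes 0 and conjugates p by the shift i -> i + 1,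
  which is the change between counting from 0 and counting from 1. Pair l counted from 0 becomes
  pair l + 1, at positions 2l + 1 and 2l + 2.\<close>

lemma pf_perms_eq: "pf_perms m = permutation_insert 0 0 ` pf_perms0 m"
proof -
  have *: "q \<in> pf_perms m \<longleftrightarrow> p \<in> pf_perms0 m"
    if p: "p permutes {0..<2 * m}" and q: "q = permutation_insert 0 0 p" for p q
  proof -
    have "q permutes {0..<Suc (2 * m)}"
      unfolding q using p by (rule permutation_insert_permutes) auto
    then have "q permutes {1..2 * m}"
      by (rule permutes_superset) (auto simp: q permutation_insert_0 split: nat.split)
    moreover have "(\<forall>l \<in> {1..<m}. q (2 * l - 1) < q (2 * l + 1)) \<longleftrightarrow> 
       (\<forall>l. Suc l < m \<longrightarrow> p (2 * l) < p (2 * l + 2))" (is "?L \<longleftrightarrow> ?R")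
    proof
      assume L: ?L
      show ?R
      proof (intro allI impI)
        fix l assume "Suc l < m"
        with L have "q (2 * Suc l - 1) < q (2 * Suc l + 1)" by (auto simp del: mult_Suc_right)
        then show "p (2 * l) < p (2 * l + 2)" by (simp add: q permutation_insert_0)
      qed
    next
      assume R: ?R
      show ?L
      proof
        fix l assume "l \<in> {1..<m}"
        then obtain l' where l': "l = Suc l'" "Suc l' < m" by (cases l) auto
        with R have "p (2 * l') < p (2 * l' + 2)" by auto
        then show "q (2 * l - 1) < q (2 * l + 1)" by (simp add: q permutation_insert_0 l')
      qed
    qed
    moreover have "(\<forall>l \<in> {1..m}. q (2 * l - 1) < q (2 * l)) \<longleftrightarrow> 
       (\<forall>l<m. p (2 * l) < p (2 * l + 1))" (is "?L \<longleftrightarrow> ?R")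
    proof
      assume L: ?L
      show ?R
      proof (intro allI impI)
        fix l assume "l < m"
        with L have "q (2 * Suc l - 1) < q (2 * Suc l)" by (auto simp del: mult_Suc_right)
        then show "p (2 * l) < p (2 * l + 1)" by (simp add: q permutation_insert_0)
      qed
    next
      assume R: ?R
      show ?L
      proof
        fix l assume "l \<in> {1..m}"
        then obtain l' where l': "l = Suc l'" "l' < m" by (cases l) auto
        with R have "p (2 * l') < p (2 * l' + 1)" by auto
        then show "q (2 * l - 1) < q (2 * l)" by (simp add: q permutation_insert_0 l')
      qed
    qed
    ultimately show ?thesis using p by (simp add: pf_perms_def pf_perms0_def)
  qed
  show ?thesis
  proof (intro equalityI subsetI)
    fix q assume q: "q \<in> pf_perms m"
    then have q': "q permutes {1..2 * m}" by (simp add: pf_perms_def)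
    then have qp: "q permutes {0..<Suc (2 * m)}" by (rule permutes_subset) auto
    \<comment> \<open>A permutation of 1..2m does not move 0, so removing position 0 inverts the
      insertion.\<close>
    have "q 0 = 0" using q' by (rule permutes_not_in) auto
    with permutation_insert_delete[OF qp, of 0] 
    have eq: "q = permutation_insert 0 0 (permutation_delete q 0)" by simp
    with *[OF permutation_delete_permutes[OF qp], of 0 q] q
    show "q \<in> permutation_insert 0 0 ` pf_perms0 m" by auto
  next
    fix q assume "q \<in> permutation_insert 0 0 ` pf_perms0 m"
    then show "q \<in> pf_perms m" using * by (auto simp: pf_perms0_def)
  qed
qed

lemma pf_perms0_subset: "pf_perms0 m \<subseteq> {p. p permutes {0..<2 * m}}"
  by (auto simp: pf_perms0_def)

text \<open>The added fixed point leaves the sign unchanged, so only the numbering of positions and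
  values is shifted.\<close>

lemma pfaffian_eq_pf_perms0:
  fixes Y :: "'a::comm_ring_1 mat"
  assumes "dim_row Y = 2 * m"
  shows "pfaffian Y =
    (\<Sum>p\<in>pf_perms0 m. of_int (sign p) * (\<Prod>l<m. Y $$ (p (2 * l), p (2 * l + 1))))"
proof -
  have inj: "inj_on (permutation_insert 0 0) (pf_perms0 m)"
    by (rule inj_on_subset[OF permutation_insert_inj_on pf_perms0_subset]) auto
  have "pfaffian Y = (\<Sum>\<pi>\<in>pf_perms m. of_int (sign \<pi>) *
        (\<Prod>l = 1..m. Y $$ (\<pi> (2 * l - 1) - 1, \<pi> (2 * l) - 1)))"
    using assms by (simp add: pfaffian_def)
  also have "\<dots> = (\<Sum>p\<in>pf_perms0 m. of_int (sign p) * (\<Prod>l<m. Y $$ (p (2 * l), p (2 * l + 1))))"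
    unfolding pf_perms_eq sum.reindex[OF inj] o_def
  proof (rule sum.cong[OF refl])
    fix p assume "p \<in> pf_perms0 m"
    then have p: "p permutes {0..<2 * m}" by (simp add: pf_perms0_def)
    let ?q = "permutation_insert 0 0 p"
    have "(\<Prod>l = 1..m. Y $$ (?q (2 * l - 1) - 1, ?q (2 * l) - 1)) =
        (\<Prod>l<m. Y $$ (?q (2 * Suc l - 1) - 1, ?q (2 * Suc l) - 1))"
      by (rule prod.reindex_bij_witness[of _ Suc "\<lambda>l. l - 1"]) auto
    also have "\<dots> = (\<Prod>l<m. Y $$ (p (2 * l), p (2 * l + 1)))"
      by (simp add: permutation_insert_0)
    moreover have "(of_int (sign ?q) :: 'a) = of_int (sign p)"
      using signof_permutation_insert[OF p, of 0 0] by simp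
    ultimately show
      "of_int (sign ?q) * (\<Prod>l = 1..m. Y $$ (?q (2 * l - 1) - 1, ?q (2 * l) - 1))
      = of_int (sign p) * (\<Prod>l<m. Y $$ (p (2 * l), p (2 * l + 1)))"
      by simp
  qed
  finally show ?thesis .
qed

section \<open>Recursion for the permutations in the Pfaffian\<close>

text \<open>Puts a new pair (0, j + 1) in front and renumbers the old values around it. Written as
  two insertions, it inherits the sign rule for \<open>permutation_insert\<close>.\<close>

definition pf_extend :: "nat \<Rightarrow> (nat \<Rightarrow> nat) \<Rightarrow> nat \<Rightarrow> nat" where
  "pf_extend j p = permutation_insert 0 0 (permutation_insert 0 j p)"

lemma pf_extend_simps:
  "pf_extend j p 0 = 0" "pf_extend j p (Suc 0) = Suc j"
  "pf_extend j p (Suc (Suc i)) = Suc (insert_index j (p i))"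
  by (simp_all add: pf_extend_def permutation_insert_0)

text \<open>The conditions on the new first pair hold because its leading value 0 is below all
  others; the remaining ones carry over because \<open>insert_index j\<close> is strictly
  increasing.\<close>

lemma pf_extend_in_pf_perms0_iff:
  assumes p: "p permutes {0..<2 * m}" and j: "j < 2 * m + 1"
  shows "pf_extend j p \<in> pf_perms0 (Suc m) \<longleftrightarrow> p \<in> pf_perms0 m"
proof -
  have "permutation_insert 0 j p permutes {0..<Suc (2 * m)}"
    using p j by (intro permutation_insert_permutes) auto
  then have "pf_extend j p permutes {0..<Suc (Suc (2 * m))}"
    unfolding pf_extend_def by (rule permutation_insert_permutes) auto
  moreover have "(\<forall>l. Suc l < Suc m \<longrightarrow> pf_extend j p (2 * l) < pf_extend j p (2 * l + 2)) \<longleftrightarrow>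
     (\<forall>l. Suc l < m \<longrightarrow> p (2 * l) < p (2 * l + 2))"
    (is "(\<forall>l. ?L l) \<longleftrightarrow> (\<forall>l. ?R l)")
  proof -
    have "?L 0" by (simp add: pf_extend_simps)
    moreover have "?L (Suc l) \<longleftrightarrow> ?R l" for l by (simp add: pf_extend_simps)
    ultimately show ?thesis by (metis not0_implies_Suc)
  qed
  moreover have "(\<forall>l<Suc m. pf_extend j p (2 * l) < pf_extend j p (2 * l + 1)) \<longleftrightarrow>
     (\<forall>l<m. p (2 * l) < p (2 * l + 1))"
    (is "(\<forall>l<Suc m. ?L l) \<longleftrightarrow> (\<forall>l<m. ?R l)")
  proof -
    have "?L 0" by (simp add: pf_extend_simps)
    moreover have "?L (Suc l) \<longleftrightarrow> ?R l" for l by (simp add: pf_extend_simps)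
    ultimately show ?thesis unfolding All_less_Suc2 by blast
  qed
  ultimately show ?thesis using p by (simp add: pf_perms0_def)
qed

text \<open>The leading entries of the pairs increase and each lies below its partner, so p 0 is the
  least value, and 0 is attained.\<close>

lemma pf_perms0_at_0:
  assumes "p \<in> pf_perms0 (Suc m)"
  shows "p 0 = 0"
proof -
  from assms have p: "p permutes {0..<2 * Suc m}"
    and even: "\<And>l. Suc l < Suc m \<Longrightarrow> p (2 * l) < p (2 * l + 2)"
    and odd: "\<And>l. l < Suc m \<Longrightarrow> p (2 * l) < p (2 * l + 1)"
    by (auto simp: pf_perms0_def)
  have le: "p 0 \<le> p (2 * l)" if "l < Suc m" for l
    using that
  proof (induction l)
    case (Suc l)
    then show ?case using even[of l] by simp
  qed simp
  have le': "p 0 \<le> p i" if "i < 2 * Suc m" for i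
  proof (cases "even i")
    case True
    then show ?thesis using le[of "i div 2"] that by auto
  next
    case False
    then obtain l where l: "i = 2 * l + 1" by (elim oddE)
    then show ?thesis using le[of l] odd[of l] that by simp
  qed
  obtain i where i: "i \<in> {0..<2 * Suc m}" "p i = 0"
    using permutes_image[OF p]
    by (metis (no_types, lifting) atLeastLessThan_iff imageE le0 mult_pos_pos
        zero_less_Suc zero_less_numeral)
  show ?thesis using le'[of i] i by auto
qed

text \<open>Since 0 must come first, an arrangement of m + 1 pairs is determined by the partner of 0
  and an arrangement of the other m pairs.\<close>

lemma bij_betw_pf_extend:
  "bij_betw (\<lambda>(j, p). pf_extend j p) ({..<2 * m + 1} \<times> pf_perms0 m) (pf_perms0 (Suc m))"
proof (rule bij_betw_imageI)
  show "inj_on (\<lambda>(j, p). pf_extend j p) ({..<2 * m + 1} \<times> pf_perms0 m)"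
  proof (rule inj_onI, clarify)
    fix j p j' p'
    assume eq: "pf_extend j p = pf_extend j' p'"
    have "j = j'" using fun_cong[OF eq, of 1] by (simp add: pf_extend_simps)
    moreover have "p = p'"
    proof
      fix i
      show "p i = p' i" using fun_cong[OF eq, of "Suc (Suc i)"] \<open>j = j'\<close>
        by (auto simp: pf_extend_simps insert_index_def split: if_splits)
    qed
    ultimately show "j = j' \<and> p = p'" by simp
  qed
  show "(\<lambda>(j, p). pf_extend j p) ` ({..<2 * m + 1} \<times> pf_perms0 m) = pf_perms0 (Suc m)"
  proof (intro equalityI subsetI)
    fix q assume "q \<in> (\<lambda>(j, p). pf_extend j p) ` ({..<2 * m + 1} \<times> pf_perms0 m)"
    then obtain j p where "q = pf_extend j p" "j < 2 * m + 1" "p \<in> pf_perms0 m" by auto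
    then show "q \<in> pf_perms0 (Suc m)"
      using pf_extend_in_pf_perms0_iff[of p m j] by (auto simp: pf_perms0_def)
  next
    fix q assume q: "q \<in> pf_perms0 (Suc m)"
    then have perm: "q permutes {0..<Suc (Suc (2 * m))}" by (simp add: pf_perms0_def)
    \<comment> \<open>Position 0 is removed twice: first the value 0 disappears, then its partner,
      which by now has the value \<open>q1 0\<close>.\<close>
    define q1 where "q1 = permutation_delete q 0"
    have q1: "q1 permutes {0..<Suc (2 * m)}" "q = permutation_insert 0 0 q1"
      using permutation_delete_permutes[OF perm, of 0] permutation_insert_delete[OF perm, of 0]
        pf_perms0_at_0[OF q] by (simp_all add: q1_def)
    define p where "p = permutation_delete q1 0"
    have p: "p permutes {0..<2 * m}" "q1 = permutation_insert 0 (q1 0) p"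
      using permutation_delete_permutes[OF q1(1), of 0] permutation_insert_delete[OF q1(1), of 0]
      by (simp_all add: p_def)
    have j: "q1 0 < 2 * m + 1" using permutes_in_image[OF q1(1), of 0] by simp
    have eq: "q = pf_extend (q1 0) p" unfolding pf_extend_def using q1(2) p(2) by simp
    have "p \<in> pf_perms0 m"
      using pf_extend_in_pf_perms0_iff[OF p(1) j] q eq by simp
    then show "q \<in> (\<lambda>(j, p). pf_extend j p) ` ({..<2 * m + 1} \<times> pf_perms0 m)"
      using eq j by auto
  qed
qed

text \<open>Inserting value j at position 0 costs j transpositions; inserting value 0 at position 0
  costs none.\<close>

lemma sign_pf_extend:
  assumes "p permutes {0..<2 * m}" and "j < 2 * m + 1"
  shows "(of_int (sign (pf_extend j p)) :: 'a::comm_ring_1) = (-1) ^ j * of_int (sign p)"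
proof -
  have "permutation_insert 0 j p permutes {0..<Suc (2 * m)}"
    using assms by (intro permutation_insert_permutes) auto
  then show ?thesis
    using assms unfolding pf_extend_def
    by (simp add: signof_permutation_insert)
qed

text \<open>Grouping the permutations by the partner j of the first entry gives the expansion along
  the first row. Arbitrary lists of labels are needed because the recursion deletes entries;
  \<open>insert_index j\<close> reads exactly the entries of \<open>delete_nth j ys\<close>.\<close>

lemma sum_pf_perms0_eq_pf_list:
  fixes Y :: "'b \<Rightarrow> 'b \<Rightarrow> 'a::comm_ring_1"
  assumes "length xs = 2 * m"
  shows "(\<Sum>p\<in>pf_perms0 m. of_int (sign p) *
      (\<Prod>l<m. Y (xs ! p (2 * l)) (xs ! p (2 * l + 1)))) = pf_list Y xs"
  using assms
proof (induction m arbitrary: xs)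
  case 0
  have "pf_perms0 0 = {id}" by (auto simp: pf_perms0_def)
  with 0 show ?case by simp
next
  case (Suc m)
  then obtain a ys where xs: "xs = a # ys" by (cases xs) auto
  with Suc.prems have len: "length ys = 2 * m + 1" by simp
  let ?F = "\<lambda>m xs p. of_int (sign p) * (\<Prod>l<m. Y (xs ! p (2 * l)) (xs ! p (2 * l + 1)))"
  have step: "?F (Suc m) xs (pf_extend j p) = (-1) ^ j * Y a (ys ! j) * ?F m (delete_nth j ys) p"
    if j: "j < 2 * m + 1" and p: "p \<in> pf_perms0 m" for j p
  proof -
    from p have perm: "p permutes {0..<2 * m}" by (simp add: pf_perms0_def)
    have in_range: "p i < 2 * m" if "i < 2 * m" for i
      using permutes_in_image[OF perm, of i] that by simp
    have "(\<Prod>l<Suc m. Y (xs ! pf_extend j p (2 * l)) (xs ! pf_extend j p (2 * l + 1))) =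
       Y a (ys ! j) * (\<Prod>l<m. Y (ys ! insert_index j (p (2 * l))) (ys ! insert_index j (p (2 * l + 1))))"
      by (subst prod.lessThan_Suc_shift) (simp add: xs pf_extend_simps)
    also have "(\<Prod>l<m. Y (ys ! insert_index j (p (2 * l))) (ys ! insert_index j (p (2 * l + 1)))) =
       (\<Prod>l<m. Y (delete_nth j ys ! p (2 * l)) (delete_nth j ys ! p (2 * l + 1)))"
      using j len in_range by (intro prod.cong) (auto simp: nth_delete_nth)
    finally show ?thesis using sign_pf_extend[OF perm j, where 'a = 'a] by (simp add: mult_ac)
  qed
  have "sum (?F (Suc m) xs) (pf_perms0 (Suc m)) =
    (\<Sum>(j, p)\<in>{..<2 * m + 1} \<times> pf_perms0 m. ?F (Suc m) xs (pf_extend j p))"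
    by (subst sum.reindex_bij_betw[OF bij_betw_pf_extend, symmetric]) (simp add: case_prod_beta)
  also have "\<dots> = (\<Sum>j<2 * m + 1. \<Sum>p\<in>pf_perms0 m. ?F (Suc m) xs (pf_extend j p))"
    by (simp add: sum.cartesian_product)
  also have "\<dots> = (\<Sum>j<2 * m + 1. \<Sum>p\<in>pf_perms0 m.
      (-1) ^ j * Y a (ys ! j) * ?F m (delete_nth j ys) p)"
    using step by (intro sum.cong) auto
  also have "\<dots> = (\<Sum>j<2 * m + 1. (-1) ^ j * Y a (ys ! j) * pf_list Y (delete_nth j ys))"
    using Suc.IH len by (intro sum.cong) (auto simp flip: sum_distrib_left simp: length_delete_nth)
  also have "\<dots> = pf_list Y xs" using len by (simp add: xs)
  finally show ?case .
qed

lemma pfaffian_eq_pf_list: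
  assumes "dim_row Y = 2 * m"
  shows "pfaffian Y = pf_list (\<lambda>i j. Y $$ (i, j)) [0..<2 * m]"
proof -
  have "(\<Prod>l<m. Y $$ (p (2 * l), p (2 * l + 1))) =
      (\<Prod>l<m. Y $$ ([0..<2 * m] ! p (2 * l), [0..<2 * m] ! p (2 * l + 1)))"
    if "p \<in> pf_perms0 m" for p
  proof -
    from that have perm: "p permutes {0..<2 * m}" by (simp add: pf_perms0_def)
    then have "p i < 2 * m" if "i < 2 * m" for i
      using permutes_in_image[OF perm, of i] that by simp
    then show ?thesis by (intro prod.cong) auto
  qed
  then show ?thesis
    using assms by (simp add: pfaffian_eq_pf_perms0 flip: sum_pf_perms0_eq_pf_list)
qed

section \<open>Signs of tuples and multilinear expansion of the Pfaffian\<close>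

text \<open>Takes the same values as \<open>tuple_sgn [a, b]\<close>. Equal arguments give 0, so
  products of these signs vanish on repeated entries.\<close>

definition pair_sgn :: "nat \<Rightarrow> nat \<Rightarrow> int" where
  "pair_sgn a b = sgn (int b - int a)"

lemma pair_sgn_simps:
  "a < b \<Longrightarrow> pair_sgn a b = 1" "b < a \<Longrightarrow> pair_sgn a b = -1" "pair_sgn a a = 0"
  by (simp_all add: pair_sgn_def)

lemma pair_sgn_swap: "pair_sgn b a = - pair_sgn a b"
  by (simp add: pair_sgn_def sgn_if)

text \<open>The sgn of a tuple as a product over all pairs of positions instead of an inversion
  count; repeated entries give 0 without a case distinction.\<close>

primrec order_sgn :: "nat list \<Rightarrow> int" where
  "order_sgn [] = 1"
| "order_sgn (a # xs) = (\<Prod>x\<leftarrow>xs. pair_sgn a x) * order_sgn xs"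

text \<open>Moving x to the front reverses its pair with each element of \<open>us\<close>, and
  every reversal changes one sign.\<close>

lemma order_sgn_insert:
  "order_sgn (us @ x # vs) =
     (-1) ^ length us * (\<Prod>y\<leftarrow>us @ vs. pair_sgn x y) * order_sgn (us @ vs)"
proof (induction us)
  case (Cons u us)
  then show ?case by (simp add: pair_sgn_swap[of x u])
qed simp

lemma order_sgn_delete_nth:
  assumes "i < length xs"
  shows "order_sgn xs =
    (-1) ^ i * (\<Prod>y\<leftarrow>delete_nth i xs. pair_sgn (xs ! i) y) * order_sgn (delete_nth i xs)"
proof -
  have "order_sgn xs = order_sgn (take i xs @ xs ! i # drop (Suc i) xs)"
    using assms by (simp flip: id_take_nth_drop)
  then show ?thesis
    using assms unfolding order_sgn_insert by (simp add: delete_nth_def)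
qed

lemma order_sgn_not_distinct: "\<not> distinct xs \<Longrightarrow> order_sgn xs = 0"
proof (induction xs)
  case (Cons a xs)
  show ?case
  proof (cases "a \<in> set xs")
    case True
    then have "0 \<in> set (map (pair_sgn a) xs)" by (force simp: pair_sgn_simps)
    then have "prod_list (map (pair_sgn a) xs) = 0" by (simp only: prod_list_zero_iff)
    then show ?thesis by simp
  qed (use Cons in simp)
qed simp

lemma order_sgn_strictly_increasing: "sorted_wrt (<) xs \<Longrightarrow> order_sgn xs = 1"
proof (induction xs)
  case (Cons a xs)
  then have "map (pair_sgn a) xs = replicate (length xs) 1"
    by (intro replicate_eqI) (auto simp: pair_sgn_simps)
  with Cons show ?case by simp
qed simp

lemma set_delete_nth:
  assumes "distinct xs" "i < length xs"
  shows "set (delete_nth i xs) = set xs - {xs ! i}" and "distinct (delete_nth i xs)"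
proof -
  have xs: "xs = take i xs @ xs ! i # drop (Suc i) xs"
    using assms by (simp flip: id_take_nth_drop)
  have "distinct (take i xs @ xs ! i # drop (Suc i) xs)" using assms xs by simp
  moreover have "set xs = set (take i xs @ xs ! i # drop (Suc i) xs)" using xs by simp
  ultimately show "set (delete_nth i xs) = set xs - {xs ! i}" "distinct (delete_nth i xs)"
    unfolding delete_nth_def by auto
qed

lemma sorted_wrt_delete_nth: "sorted_wrt P xs \<Longrightarrow> sorted_wrt P (delete_nth i xs)"
proof -
  assume s: "sorted_wrt P xs"
  have "sorted_wrt P (take i xs @ drop i xs)" using s by simp
  then have *: "sorted_wrt P (take i xs)" "sorted_wrt P (drop i xs)"
     "\<forall>x\<in>set (take i xs). \<forall>y\<in>set (drop i xs). P x y"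
    unfolding sorted_wrt_append by auto
  have "set (drop (Suc i) xs) \<subseteq> set (drop i xs)"
    by (rule set_drop_subset_set_drop) simp
  then show ?thesis
    using * unfolding delete_nth_def sorted_wrt_append by (auto simp: sorted_wrt_drop s)
qed

section \<open>The Pfaffian of a matrix of signs\<close>

text \<open>Induction by adding a new maximum M: the old products gain only factors
  \<open>pair_sgn x M\<close> = 1, and the new summand is \<open>pair_sgn a M\<close> times (-1) to
  the size of A. Each step changes the parity of the size, so the even case with its correction 1 is
  carried along.\<close>

lemma sum_pair_sgn:
  assumes "finite A"
  shows "(\<Sum>x\<in>A. pair_sgn a x * (\<Prod>y\<in>A - {x}. pair_sgn x y)) =
    (\<Prod>x\<in>A. pair_sgn a x) - (if even (card A) then 1 else 0)"
  using assms
proof (induction A rule: finite_linorder_max_induct)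
  case (insert M A)
  have M: "M \<notin> A" using insert by auto
  have "(\<Prod>y\<in>insert M A - {x}. pair_sgn x y) = (\<Prod>y\<in>A - {x}. pair_sgn x y)" if "x \<in> A" for x
  proof -
    have "insert M A - {x} = insert M (A - {x})" using M that by auto
    then show ?thesis using insert that M by (simp add: pair_sgn_simps)
  qed
  moreover have "(\<Prod>y\<in>insert M A - {M}. pair_sgn M y) = (-1) ^ card A"
  proof -
    have "insert M A - {M} = A" using M by auto
    moreover have "(\<Prod>y\<in>A. pair_sgn M y) = (\<Prod>y\<in>A. -1)"
      using insert by (intro prod.cong) (auto simp: pair_sgn_simps)
    ultimately show ?thesis by simp
  qed
  ultimately have eq: "(\<Sum>x\<in>insert M A. pair_sgn a x * (\<Prod>y\<in>insert M A - {x}. pair_sgn x y)) =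
     pair_sgn a M * (-1) ^ card A + (\<Prod>x\<in>A. pair_sgn a x) - (if even (card A) then 1 else 0)"
    using insert M by simp
  show ?case
  proof (cases "a < M")
    case True
    then show ?thesis unfolding eq using insert M by (auto simp: pair_sgn_simps)
  next
    \<comment> \<open>Whether a equals M or exceeds it, every element of A lies below a.\<close>
    case False
    have "(\<Prod>y\<in>A. pair_sgn a y) = (\<Prod>y\<in>A. -1)"
      using insert False by (intro prod.cong) (force simp: pair_sgn_simps)+
    then have "(\<Prod>y\<in>A. pair_sgn a y) = (-1) ^ card A" by simp
    then show ?thesis unfolding eq using insert M by auto
  qed
qed simp

lemma order_sgn_expand_distinct:
  assumes "distinct xs" "odd (length xs)"
  shows "(\<Sum>i<length xs. (-1) ^ i * pair_sgn a (xs ! i) * order_sgn (delete_nth i xs)) =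
    order_sgn (a # xs)"
proof -
  have summand: "(-1) ^ i * pair_sgn a (xs ! i) * order_sgn (delete_nth i xs) =
      order_sgn xs * (pair_sgn a (xs ! i) * (\<Prod>y\<in>set xs - {xs ! i}. pair_sgn (xs ! i) y))"
    if i: "i < length xs" for i
  proof -
    \<comment> \<open>P is the sign product of the entry at i against all others. As the entries are
      distinct, P squares to 1 and can be moved across the equation, so that
      \<open>order_sgn xs\<close> becomes a common factor of all summands.\<close>
    define P where "P = (\<Prod>y\<in>set xs - {xs ! i}. pair_sgn (xs ! i) y)"
    have "P * P = (\<Prod>y\<in>set xs - {xs ! i}. 1)"
      unfolding P_def prod.distrib[symmetric]
      by (intro prod.cong) (auto simp: pair_sgn_def sgn_if)
    then have PP: "P * P = 1" by simp
    have "(\<Prod>y\<leftarrow>delete_nth i xs. pair_sgn (xs ! i) y) = P"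
      using prod.distinct_set_conv_list[OF set_delete_nth(2)[OF assms(1) i], of "pair_sgn (xs ! i)"]
      unfolding P_def set_delete_nth(1)[OF assms(1) i] by simp
    then have "order_sgn xs * P = (-1) ^ i * (P * P) * order_sgn (delete_nth i xs)"
      using order_sgn_delete_nth[OF i] by (simp add: mult_ac)
    then show ?thesis using PP by (simp add: P_def[symmetric] mult_ac)
  qed
  have "(\<Sum>i<length xs. (-1) ^ i * pair_sgn a (xs ! i) * order_sgn (delete_nth i xs)) =
     order_sgn xs *
       (\<Sum>i<length xs. pair_sgn a (xs ! i) * (\<Prod>y\<in>set xs - {xs ! i}. pair_sgn (xs ! i) y))"
    unfolding sum_distrib_left by (rule sum.cong[OF refl], rule summand) simp
  also have "(\<Sum>i<length xs. pair_sgn a (xs ! i) * (\<Prod>y\<in>set xs - {xs ! i}. pair_sgn (xs ! i) y)) =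
     (\<Sum>x\<in>set xs. pair_sgn a x * (\<Prod>y\<in>set xs - {x}. pair_sgn x y))"
    by (rule sum.reindex_bij_betw[OF bij_betw_nth]) (use assms in auto)
  also have "\<dots> = (\<Prod>x\<in>set xs. pair_sgn a x)"
    using assms by (simp add: sum_pair_sgn distinct_card)
  also have "\<dots> = (\<Prod>x\<leftarrow>xs. pair_sgn a x)"
    using assms by (simp add: prod.distinct_set_conv_list)
  finally show ?thesis by simp
qed

text \<open>Neither of the two equal entries is removed. Their new positions are given by
  \<open>delete_index i\<close> and stay different because \<open>insert_index i\<close> recovers p
  and q from them.\<close>

lemma not_distinct_delete_nth:
  assumes "xs ! p = xs ! q" "p < q" "q < length xs" "i \<noteq> p" "i \<noteq> q" "i < length xs"
  shows "\<not> distinct (delete_nth i xs)"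
proof
  assume d: "distinct (delete_nth i xs)"
  have eq: "insert_index i (delete_index i p) = p" "insert_index i (delete_index i q) = q"
    using assms by (auto simp: insert_index_def delete_index_def)
  have less: "delete_index i p < length xs - 1" "delete_index i q < length xs - 1"
    using assms by (auto simp: delete_index_def)
  have "delete_nth i xs ! delete_index i p = delete_nth i xs ! delete_index i q"
    using less assms eq by (simp add: nth_delete_nth)
  then have "delete_index i p = delete_index i q"
    using d less assms by (simp add: nth_eq_iff_index_eq length_delete_nth)
  then show False using eq assms by simp
qed

text \<open>
  If \<open>x\<close> is repeated, only the deletions of one of two fixed occurrences of \<open>x\<close> can leave a
  distinct list, and these two terms cancel.
\<close>

lemma order_sgn_expand_not_distinct:
  assumes "\<not> distinct xs"
  shows "(\<Sum>i<length xs. (-1) ^ i * pair_sgn a (xs ! i) * order_sgn (delete_nth i xs)) = 0"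
proof -
  from not_distinct_decomp[OF assms] obtain us x vs ws where
    xs: "xs = us @ [x] @ vs @ [x] @ ws" by blast
  define p where "p = length us"
  define q where "q = length us + 1 + length vs"
  have pq: "p < q" "q < length xs" "xs ! p = x" "xs ! q = x"
    by (simp_all add: p_def q_def xs nth_append)
  have del: "delete_nth p xs = (us @ vs) @ x # ws" "delete_nth q xs = us @ x # (vs @ ws)"
    by (simp_all add: p_def q_def xs delete_nth_def)
  have "(\<Sum>i<length xs. (-1) ^ i * pair_sgn a (xs ! i) * order_sgn (delete_nth i xs)) =
    (\<Sum>i\<in>{p, q}. (-1) ^ i * pair_sgn a (xs ! i) * order_sgn (delete_nth i xs))"
  proof (rule sum.mono_neutral_right)
    show "\<forall>i\<in>{..<length xs} - {p, q}.
        (-1) ^ i * pair_sgn a (xs ! i) * order_sgn (delete_nth i xs) = 0"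
      using not_distinct_delete_nth[of xs p q] pq by (auto simp: order_sgn_not_distinct)
  qed (use pq in auto)
  also have "\<dots> = (-1) ^ p * pair_sgn a x * order_sgn (delete_nth p xs) +
      (-1) ^ q * pair_sgn a x * order_sgn (delete_nth q xs)"
    using pq by simp
  \<comment> \<open>Moving x to the front turns both lists into x followed by
    \<open>us @ vs @ ws\<close>. The total exponents are 2|us| + |vs| and 2|us| + |vs| + 1, so the
    terms have opposite signs.\<close>
  also have "\<dots> = 0"
    unfolding del order_sgn_insert by (simp add: p_def q_def power_add)
  finally show ?thesis .
qed

text \<open>This is the first-row recursion of \<open>pf_list\<close> for the matrix of pair signs.
  If \<open>xs\<close> has a repetition, both sides vanish.\<close>

lemma order_sgn_expand:
  assumes "odd (length xs)"
  shows "(\<Sum>i<length xs. (-1) ^ i * pair_sgn a (xs ! i) * order_sgn (delete_nth i xs)) =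
    order_sgn (a # xs)"
proof (cases "distinct xs")
  case False
  then have "order_sgn (a # xs) = 0" by (simp add: order_sgn_not_distinct)
  then show ?thesis using order_sgn_expand_not_distinct[OF False] by simp
qed (use assms order_sgn_expand_distinct in auto)

lemma sum_list_delete_nth:
  fixes xs :: "'a::comm_monoid_add list"
  assumes "i < length xs"
  shows "sum_list xs = xs ! i + sum_list (delete_nth i xs)"
proof -
  have "sum_list xs = sum_list (take i xs @ xs ! i # drop (Suc i) xs)"
    using assms by (simp flip: id_take_nth_drop)
  then show ?thesis by (simp add: delete_nth_def add_ac)
qed

text \<open>In every summand of the Pfaffian each entry of g occurs exactly once, so the factors
  (-1)^u combine to the sign of the sum. What remains satisfies the recursion of
  \<open>order_sgn_expand\<close>; removing two entries at a time keeps the length even.\<close>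

lemma pf_list_signs:
  assumes "even (length g)"
  shows "pf_list (\<lambda>u v. of_int ((-1) ^ (u + v) * pair_sgn u v) :: 'a::comm_ring_1) g =
    of_int ((-1) ^ sum_list g * order_sgn g)"
  using assms
proof (induction "length g" arbitrary: g rule: less_induct)
  case less
  show ?case
  proof (cases g)
    case (Cons a xs)
    then have odd: "odd (length xs)" using less.prems by simp
    have summand: "(-1) ^ i * of_int ((-1) ^ (a + xs ! i) * pair_sgn a (xs ! i)) *
         pf_list (\<lambda>u v. of_int ((-1) ^ (u + v) * pair_sgn u v) :: 'a) (delete_nth i xs)
       = of_int ((-1) ^ sum_list g * ((-1) ^ i * pair_sgn a (xs ! i) * order_sgn (delete_nth i xs)))"
      if i: "i < length xs" for i
    proof -
      have "length (delete_nth i xs) < length g" "even (length (delete_nth i xs))"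
        using i odd Cons by (simp_all add: length_delete_nth)
      from less.hyps[OF this]
      have "pf_list (\<lambda>u v. of_int ((-1) ^ (u + v) * pair_sgn u v) :: 'a) (delete_nth i xs) =
        of_int ((-1) ^ sum_list (delete_nth i xs) * order_sgn (delete_nth i xs))" .
      then show ?thesis using sum_list_delete_nth[OF i]
        by (simp add: Cons power_add mult_ac)
    qed
    have "pf_list (\<lambda>u v. of_int ((-1) ^ (u + v) * pair_sgn u v) :: 'a) g =
      (\<Sum>i<length xs. of_int ((-1) ^ sum_list g *
        ((-1) ^ i * pair_sgn a (xs ! i) * order_sgn (delete_nth i xs))))"
      unfolding Cons pf_list.simps using summand[unfolded Cons] by (intro sum.cong) auto
    also have "\<dots> = of_int ((-1) ^ sum_list g *
        (\<Sum>i<length xs. (-1) ^ i * pair_sgn a (xs ! i) * order_sgn (delete_nth i xs)))"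
      by (simp add: sum_distrib_left)
    also have "\<dots> = of_int ((-1) ^ sum_list g * order_sgn g)"
      unfolding order_sgn_expand[OF odd] Cons ..
    finally show ?thesis .
  qed simp
qed

section \<open>Multilinear expansion of the Pfaffian\<close>

lemma pf_list_cong:
  assumes "\<And>i j. i \<in> set xs \<Longrightarrow> j \<in> set xs \<Longrightarrow> Y i j = Z i j"
  shows "pf_list Y xs = pf_list Z xs"
  using assms
proof (induction "length xs" arbitrary: xs rule: less_induct)
  case less
  show ?case
  proof (cases xs)
    case (Cons a ys)
    have "pf_list Y (delete_nth i ys) = pf_list Z (delete_nth i ys)" if "i < length ys" for i
      using that Cons
      by (intro less) (auto simp: length_delete_nth delete_nth_def dest: in_set_takeD in_set_dropD)
    then show ?thesis using Cons less.prems by (auto intro!: sum.cong)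
  qed simp
qed

definition lists_of_length :: "nat \<Rightarrow> 'b set \<Rightarrow> 'b list set" where
  "lists_of_length k R = {g. set g \<subseteq> R \<and> length g = k}"

lemma finite_lists_of_length: "finite R \<Longrightarrow> finite (lists_of_length k R)"
  unfolding lists_of_length_def by (rule finite_lists_length_eq)

text \<open>A list corresponds to its entry at position i together with the list left after deleting
  it. The later proofs split off the first, a middle, or the last entry this way.\<close>

lemma sum_lists_of_length_insert:
  assumes "i \<le> k"
  shows "(\<Sum>g\<in>lists_of_length (Suc k) R. f g) =
    (\<Sum>v\<in>R. \<Sum>g\<in>lists_of_length k R. f (take i g @ v # drop i g))"
proof -
  have "(\<Sum>g\<in>lists_of_length (Suc k) R. f g) =
    (\<Sum>(v, g)\<in>R \<times> lists_of_length k R. f (take i g @ v # drop i g))"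
  proof (rule sum.reindex_bij_witness
      [of _ "\<lambda>(v, g). take i g @ v # drop i g" "\<lambda>g. (g ! i, delete_nth i g)"])
    fix g :: "'b list" assume g: "g \<in> lists_of_length (Suc k) R"
    then have i: "i < length g" using assms by (simp add: lists_of_length_def)
    have eq: "take i (delete_nth i g) @ g ! i # drop i (delete_nth i g) = g"
      using i id_take_nth_drop[OF i] by (simp add: delete_nth_def)
    then show "(case (g ! i, delete_nth i g) of (v, g) \<Rightarrow> take i g @ v # drop i g) = g"
      by simp
    show "(case (g ! i, delete_nth i g) of (v, g) \<Rightarrow> f (take i g @ v # drop i g)) = f g"
      using eq by simp
    show "(g ! i, delete_nth i g) \<in> R \<times> lists_of_length k R"
      using g i by (auto simp: lists_of_length_def length_delete_nth delete_nth_def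
          dest: in_set_takeD in_set_dropD)
  next
    fix vg assume "vg \<in> R \<times> lists_of_length k R"
    then obtain v g where vg: "vg = (v, g)" "v \<in> R" "set g \<subseteq> R" "length g = k"
      by (auto simp: lists_of_length_def)
    then show "(case vg of (v, g) \<Rightarrow> take i g @ v # drop i g) \<in> lists_of_length (Suc k) R"
      using assms by (auto simp: lists_of_length_def dest: in_set_takeD in_set_dropD)
    show "((case vg of (v, g) \<Rightarrow> take i g @ v # drop i g) ! i,
        delete_nth i (case vg of (v, g) \<Rightarrow> take i g @ v # drop i g)) = vg"
      using vg assms by (simp add: delete_nth_def nth_append min_def)
  qed
  then show ?thesis by (simp add: sum.cartesian_product)
qed

text \<open>The monomial of a choice of rows g for the columns \<open>ys\<close>. Pairing by
  \<open>zip\<close> lets rows and columns be deleted in parallel.\<close>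

definition pair_weight :: "('b \<Rightarrow> 'c \<Rightarrow> 'a::comm_ring_1) \<Rightarrow> 'b list \<Rightarrow> 'c list \<Rightarrow> 'a" where
  "pair_weight x g ys = (\<Prod>(u, y)\<leftarrow>zip g ys. x u y)"

lemma pair_weight_Cons: "pair_weight x (u # g) (y # ys) = x u y * pair_weight x g ys"
  by (simp add: pair_weight_def)

lemma pair_weight_insert:
  assumes "i < length ys" "Suc (length g) = length ys"
  shows "pair_weight x (take i g @ v # drop i g) ys = x v (ys ! i) * pair_weight x g (delete_nth i ys)"
proof -
  have "pair_weight x (take i g @ v # drop i g) ys =
     pair_weight x (take i g @ v # drop i g) (take i ys @ ys ! i # drop (Suc i) ys)"
    using assms by (simp flip: id_take_nth_drop)
  also have "\<dots> = x v (ys ! i) * pair_weight x (take i g @ drop i g) (take i ys @ drop (Suc i) ys)"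
    using assms unfolding pair_weight_def by (subst (1 2) zip_append) (simp_all add: mult_ac)
  finally show ?thesis by (simp add: delete_nth_def)
qed

text \<open>A Cauchy-Binet type expansion. In the first-row expansion the entry for columns y and
  \<open>zs ! i\<close> supplies their rows u and v, and the induction hypothesis supplies the rows
  of the other columns; inserting v at position i assembles the full tuple.\<close>

lemma pf_list_congruence:
  fixes x :: "'b \<Rightarrow> 'c \<Rightarrow> 'a::comm_ring_1"
  shows "pf_list (\<lambda>i j. \<Sum>u\<in>R. \<Sum>v\<in>R. x u i * d u v * x v j) ys =
    (\<Sum>g\<in>lists_of_length (length ys) R. pair_weight x g ys * pf_list d g)"
proof (induction "length ys" arbitrary: ys rule: less_induct)
  case less
  let ?Y = "\<lambda>i j. \<Sum>u\<in>R. \<Sum>v\<in>R. x u i * d u v * x v j"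
  show ?case
  proof (cases ys)
    case Nil
    have "lists_of_length 0 R = {[]}" by (auto simp: lists_of_length_def)
    then show ?thesis by (simp add: Nil pair_weight_def)
  next
    case (Cons y zs)
    have summand: "(\<Sum>u\<in>R. \<Sum>g\<in>lists_of_length (length zs) R. x u y * pair_weight x g zs *
            ((-1) ^ i * d u (g ! i) * pf_list d (delete_nth i g)))
         = (-1) ^ i * ?Y y (zs ! i) * pf_list ?Y (delete_nth i zs)" if i: "i < length zs" for i
    proof -
      obtain k where k: "length zs = Suc k" using i by (cases "length zs") auto
      then have ik: "i \<le> k" using i by simp
      have IH: "pf_list ?Y (delete_nth i zs) =
         (\<Sum>g\<in>lists_of_length k R. pair_weight x g (delete_nth i zs) * pf_list d g)"
        using less[of "delete_nth i zs"] i Cons k by (simp add: length_delete_nth)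
      have "(\<Sum>u\<in>R. \<Sum>g\<in>lists_of_length (length zs) R. x u y * pair_weight x g zs *
            ((-1) ^ i * d u (g ! i) * pf_list d (delete_nth i g))) =
          (\<Sum>u\<in>R. \<Sum>v\<in>R. \<Sum>g\<in>lists_of_length k R.
            x u y * (x v (zs ! i) * pair_weight x g (delete_nth i zs)) * ((-1) ^ i * d u v * pf_list d g))"
        unfolding k sum_lists_of_length_insert[OF ik]
      proof (intro sum.cong refl)
        fix u v g assume "g \<in> lists_of_length k R"
        then have g: "length g = k" by (simp add: lists_of_length_def)
        have "(take i g @ v # drop i g) ! i = v" "delete_nth i (take i g @ v # drop i g) = g"
          using g ik by (simp_all add: nth_append delete_nth_def min_def)
        then show "x u y * pair_weight x (take i g @ v # drop i g) zs *
          ((-1) ^ i * d u ((take i g @ v # drop i g) ! i) *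
            pf_list d (delete_nth i (take i g @ v # drop i g))) =
          x u y * (x v (zs ! i) * pair_weight x g (delete_nth i zs)) * ((-1) ^ i * d u v * pf_list d g)"
          using g k i by (simp add: pair_weight_insert)
      qed
      also have "\<dots> = (-1) ^ i * ?Y y (zs ! i) * pf_list ?Y (delete_nth i zs)"
        unfolding IH sum_distrib_left[of "(-1) ^ i"] sum_distrib_right
        unfolding sum_distrib_left by (intro sum.cong refl) (simp add: mult_ac)
      finally show ?thesis .
    qed
    \<comment> \<open>Starting from the right-hand side, the first row u is split off and
      \<open>pf_list d (u # g)\<close> is expanded; then the sum over i is moved outermost to
      compare term by term.\<close>
    have "(\<Sum>g\<in>lists_of_length (length ys) R. pair_weight x g ys * pf_list d g) =
       (\<Sum>u\<in>R. \<Sum>g\<in>lists_of_length (length zs) R. \<Sum>i<length zs. x u y * pair_weight x g zs *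
            ((-1) ^ i * d u (g ! i) * pf_list d (delete_nth i g)))"
      unfolding Cons list.size add_0_right add_Suc_right sum_lists_of_length_insert[OF le0]
      by (intro sum.cong refl) (simp add: pair_weight_Cons sum_distrib_left lists_of_length_def)
    also have "\<dots> = (\<Sum>i<length zs. \<Sum>u\<in>R. \<Sum>g\<in>lists_of_length (length zs) R. x u y * pair_weight x g zs *
            ((-1) ^ i * d u (g ! i) * pf_list d (delete_nth i g)))"
      unfolding sum.swap[of _ "{..<length zs}"] by (simp add: sum.swap[of _ _ "{..<length zs}"])
    also have "\<dots> = (\<Sum>i<length zs. (-1) ^ i * ?Y y (zs ! i) * pf_list ?Y (delete_nth i zs))"
      by (rule sum.cong[OF refl]) (use summand in simp)
    also have "\<dots> = pf_list ?Y ys" by (simp add: Cons)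
    finally show ?thesis ..
  qed
qed

section \<open>Cullis' determinant as a sum over row tuples\<close>

lemma sum_permutations_of_set_Cons:
  assumes "finite A" "A \<noteq> {}"
  shows "(\<Sum>g\<in>permutations_of_set A. f g) =
    (\<Sum>x\<in>A. \<Sum>g\<in>permutations_of_set (A - {x}). f (x # g))"
proof -
  have "(\<Sum>g\<in>permutations_of_set A. f g) =
      (\<Sum>x\<in>A. \<Sum>g\<in>(#) x ` permutations_of_set (A - {x}). f g)"
    unfolding permutations_of_set_nonempty[OF assms(2)]
    by (rule sum.UNION_disjoint) (use assms in auto)
  also have "\<dots> = (\<Sum>x\<in>A. \<Sum>g\<in>permutations_of_set (A - {x}). f (x # g))"
    by (rule sum.cong[OF refl]) (simp add: sum.reindex)
  finally show ?thesis .
qed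

text \<open>Leibniz' formula indexed by row tuples. Laplace expansion along the first column matches
  the recursion of \<open>order_sgn\<close>: exactly i rows are smaller than \<open>c ! i\<close>,
  so its pair signs against the others multiply to the cofactor sign.\<close>

lemma det_rows_eq_sum_permutations:
  fixes x :: "nat \<Rightarrow> nat \<Rightarrow> 'a::comm_ring_1"
  assumes "sorted_wrt (<) c" "length c = k"
  shows "det (mat k k (\<lambda>(a, b). x (c ! a) b)) =
    (\<Sum>g\<in>permutations_of_set (set c). of_int (order_sgn g) * (\<Prod>b<k. x (g ! b) b))"
  using assms
proof (induction k arbitrary: c x)
  case (Suc k)
  let ?A = "mat (Suc k) (Suc k) (\<lambda>(a, b). x (c ! a) b)"
  let ?h = "\<lambda>r. \<Sum>g\<in>permutations_of_set (set c - {r}).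
    of_int (order_sgn (r # g)) * (\<Prod>b<Suc k. x ((r # g) ! b) b)"
  have dist: "distinct c" using Suc.prems(1) by (simp add: strict_sorted_iff)
  have "det ?A = (\<Sum>i<Suc k. ?A $$ (i, 0) * cofactor ?A i 0)"
    by (rule laplace_expansion_column) auto
  also have "\<dots> = (\<Sum>i<length c. ?h (c ! i))"
  proof (rule sum.cong)
    fix i assume "i \<in> {..<length c}"
    then have i: "i < length c" by simp
    let ?c = "delete_nth i c"
    have c: "sorted_wrt (<) ?c" "length ?c = k" "set ?c = set c - {c ! i}" "distinct ?c"
      using Suc.prems i dist by (simp_all add: sorted_wrt_delete_nth length_delete_nth set_delete_nth)
    \<comment> \<open>Dropping column 0 shifts the remaining columns, so the induction hypothesis is
      applied to x with its column index raised by one.\<close>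
    have "mat_delete ?A i 0 = mat k k (\<lambda>(a, b). x (?c ! a) (Suc b))"
      using i Suc.prems
      by (intro eq_matI) (auto simp: mat_delete_def nth_delete_nth insert_index_def)
    then have det: "det (mat_delete ?A i 0) = (\<Sum>g\<in>permutations_of_set (set c - {c ! i}).
        of_int (order_sgn g) * (\<Prod>b<k. x (g ! b) (Suc b)))"
      using Suc.IH[OF c(1,2), of "\<lambda>u b. x u (Suc b)"] c(3) by simp
    \<comment> \<open>Both \<open>c\<close> and \<open>?c\<close> are increasing and have sign 1, so
      \<open>order_sgn_delete_nth\<close> determines the product of pair signs.\<close>
    have "(-1) ^ i * (\<Prod>y\<leftarrow>?c. pair_sgn (c ! i) y) = 1"
      using order_sgn_delete_nth[OF i] order_sgn_strictly_increasing[OF Suc.prems(1)]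
        order_sgn_strictly_increasing[OF c(1)] by simp
    then have "(-1) ^ i * ((-1) ^ i * (\<Prod>y\<leftarrow>?c. pair_sgn (c ! i) y)) = (-1) ^ i" by simp
    then have "(\<Prod>y\<leftarrow>?c. pair_sgn (c ! i) y) = (-1) ^ i"
      by (simp flip: mult.assoc power_add)
    then have rank: "(\<Prod>y\<in>set c - {c ! i}. pair_sgn (c ! i) y) = (-1) ^ i"
      using prod.distinct_set_conv_list[OF c(4), of "pair_sgn (c ! i)"] c(3) by simp
    have sgn: "order_sgn (c ! i # g) = (-1) ^ i * order_sgn g"
      if "g \<in> permutations_of_set (set c - {c ! i})" for g
      using prod.distinct_set_conv_list[of g "pair_sgn (c ! i)"] rank permutations_of_setD[OF that]
      by simp
    have "?h (c ! i) = (\<Sum>g\<in>permutations_of_set (set c - {c ! i}).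
       x (c ! i) 0 * ((-1) ^ i * (of_int (order_sgn g) * (\<Prod>b<k. x (g ! b) (Suc b)))))"
    proof (intro sum.cong refl)
      fix g assume "g \<in> permutations_of_set (set c - {c ! i})"
      then show "of_int (order_sgn (c ! i # g)) * (\<Prod>b<Suc k. x ((c ! i # g) ! b) b) =
        x (c ! i) 0 * ((-1) ^ i * (of_int (order_sgn g) * (\<Prod>b<k. x (g ! b) (Suc b))))"
        unfolding sgn[OF \<open>g \<in> _\<close>] prod.lessThan_Suc_shift by (simp add: mult_ac)
    qed
    also have "\<dots> = x (c ! i) 0 * ((-1) ^ i * det (mat_delete ?A i 0))"
      unfolding det by (simp add: sum_distrib_left)
    finally show "?A $$ (i, 0) * cofactor ?A i 0 = ?h (c ! i)"
      using i Suc.prems by (simp add: cofactor_def)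
  qed (use Suc.prems in simp)
  also have "\<dots> = (\<Sum>r\<in>set c. ?h r)"
    by (rule sum.reindex_bij_betw[OF bij_betw_nth]) (use dist in auto)
  also have "\<dots> = (\<Sum>g\<in>permutations_of_set (set c). of_int (order_sgn g) * (\<Prod>b<Suc k. x (g ! b) b))"
    by (rule sum_permutations_of_set_Cons[symmetric]) (use Suc.prems in auto)
  finally show ?case .
qed simp

text \<open>The common form to which determinant and Pfaffian are both reduced. Rows are counted
  from 1 because their numbers enter the sign; columns are counted from 0.\<close>

definition signed_row_sum :: "nat \<Rightarrow> nat \<Rightarrow> (nat \<Rightarrow> nat \<Rightarrow> 'a::comm_ring_1) \<Rightarrow> 'a" where
  "signed_row_sum n k x = (\<Sum>g\<in>lists_of_length k {1..n}.
     of_int ((-1) ^ sum_list g * order_sgn g) * (\<Prod>b<k. x (g ! b) b))"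

text \<open>Each tuple with distinct entries rearranges exactly one increasing tuple, found by
  sorting, and has the same sum of entries; tuples with repetitions have sign 0.\<close>

lemma sum_increasing_tuples_det:
  fixes x :: "nat \<Rightarrow> nat \<Rightarrow> 'a::comm_ring_1"
  shows "(\<Sum>c\<in>increasing_tuples n k. (-1) ^ sum_list c * det (mat k k (\<lambda>(a, b). x (c ! a) b))) =
    signed_row_sum n k x"
proof -
  let ?f = "\<lambda>g. of_int ((-1) ^ sum_list g * order_sgn g) * (\<Prod>b<k. x (g ! b) b)"
  have fin: "finite (increasing_tuples n k)"
    by (rule finite_subset[OF _ finite_lists_of_length[of "{1..n}" k]])
      (auto simp: increasing_tuples_def lists_of_length_def)
  have "(\<Sum>c\<in>increasing_tuples n k. (-1) ^ sum_list c * det (mat k k (\<lambda>(a, b). x (c ! a) b))) =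
    (\<Sum>c\<in>increasing_tuples n k. \<Sum>g\<in>permutations_of_set (set c). ?f g)"
  proof (intro sum.cong refl)
    fix c assume "c \<in> increasing_tuples n k"
    then have c: "sorted_wrt (<) c" "length c = k" by (auto simp: increasing_tuples_def)
    have dist: "distinct c" using c(1) by (simp add: strict_sorted_iff)
    have "sum_list g = sum_list c" if "g \<in> permutations_of_set (set c)" for g
      using sum.distinct_set_conv_list[of g "\<lambda>x. x"] sum.distinct_set_conv_list[OF dist, of "\<lambda>x. x"]
        permutations_of_setD[OF that] by simp
    then show "(-1) ^ sum_list c * det (mat k k (\<lambda>(a, b). x (c ! a) b)) =
        (\<Sum>g\<in>permutations_of_set (set c). ?f g)"
      unfolding det_rows_eq_sum_permutations[OF c] sum_distrib_left
      by (intro sum.cong refl) (simp add: mult_ac)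
  qed
  also have "\<dots> = (\<Sum>(c, g)\<in>(SIGMA c:increasing_tuples n k. permutations_of_set (set c)). ?f g)"
    by (rule sum.Sigma) (use fin in auto)
  also have "\<dots> = (\<Sum>g | g \<in> lists_of_length k {1..n} \<and> distinct g. ?f g)"
  proof (rule sum.reindex_bij_witness[of _ "\<lambda>g. (sorted_list_of_set (set g), g)" snd])
    fix cg assume "cg \<in> (SIGMA c:increasing_tuples n k. permutations_of_set (set c))"
    then obtain c g where cg: "cg = (c, g)" "length c = k" "sorted_wrt (<) c" "set c \<subseteq> {1..n}"
       "set g = set c" "distinct g"
      by (auto simp: increasing_tuples_def dest: permutations_of_setD)
    have "sorted_list_of_set (set c) = c"
      using cg(3) by (simp add: strict_sorted_iff sorted_list_of_set.idem_if_sorted_distinct)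
    with cg show "(sorted_list_of_set (set (snd cg)), snd cg) = cg" by simp
    have "length g = k"
      using cg distinct_card[of g] distinct_card[of c] by (simp add: strict_sorted_iff)
    with cg show "snd cg \<in> {g \<in> lists_of_length k {1..n}. distinct g}"
      by (auto simp: lists_of_length_def)
  qed (auto simp: increasing_tuples_def lists_of_length_def distinct_card)
  also have "\<dots> = signed_row_sum n k x"
    unfolding signed_row_sum_def
    by (rule sum.mono_neutral_left) (auto simp: finite_lists_of_length order_sgn_not_distinct)
  finally show ?thesis .
qed

lemma cullis_det_eq_signed_row_sum:
  assumes "X \<in> carrier_mat n k" "k \<le> n"
  shows "cullis_det X = (-1) ^ (\<Sum>{1..k}) * signed_row_sum n k (\<lambda>u b. X $$ (u - 1, b))"
  using assms by (simp add: cullis_det_def cullis_det_tall_def sum_increasing_tuples_det[symmetric])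

lemma pfaffian_eq_signed_row_sum:
  fixes X :: "'a::comm_ring_1 mat"
  assumes X: "X \<in> carrier_mat n k" and "even k"
  shows "pfaffian (X\<^sup>T * D_mat n * X) = signed_row_sum n k (\<lambda>u b. X $$ (u - 1, b))"
proof -
  obtain m where k: "k = 2 * m" using \<open>even k\<close> by blast
  let ?Y = "X\<^sup>T * D_mat n * X"
  let ?x = "\<lambda>u b. X $$ (u - 1, b)"
  let ?d = "\<lambda>u v. of_int ((-1) ^ (u + v) * pair_sgn u v) :: 'a"
  have dim_D: "dim_row (D_mat n :: 'a mat) = n" "dim_col (D_mat n :: 'a mat) = n"
    using D_mat_carrier[of n, where 'a = 'a] by auto
  have entry: "?Y $$ (i, j) = (\<Sum>u\<in>{1..n}. \<Sum>v\<in>{1..n}. ?x u i * ?d u v * ?x v j)"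
    if ij: "i < k" "j < k" for i j
  proof -
    have "?Y $$ (i, j) = (\<Sum>v<n. (\<Sum>u<n. X $$ (u, i) * D_mat n $$ (u, v)) * X $$ (v, j))"
      using X ij by (auto simp: scalar_prod_def atLeast0LessThan dim_D intro!: sum.cong)
    also have "\<dots> = (\<Sum>v<n. \<Sum>u<n. X $$ (u, i) * ?d (Suc u) (Suc v) * X $$ (v, j))"
      unfolding sum_distrib_right
      by (intro sum.cong refl) (auto simp: D_mat_def tuple_sgn_pair pair_sgn_def sgn_if)
    also have "\<dots> = (\<Sum>u<n. \<Sum>v<n. X $$ (u, i) * ?d (Suc u) (Suc v) * X $$ (v, j))"
      by (rule sum.swap)
    also have "\<dots> = (\<Sum>u\<in>{1..n}. \<Sum>v\<in>{1..n}. ?x u i * ?d u v * ?x v j)"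
      by (simp add: sum.atLeast1_atMost_eq lessThan_Suc_atMost del: of_int_mult)
    finally show ?thesis .
  qed
  have "dim_row ?Y = 2 * m" using X k by simp
  then have "pfaffian ?Y = pf_list (\<lambda>i j. ?Y $$ (i, j)) [0..<k]"
    unfolding k by (rule pfaffian_eq_pf_list)
  also have "\<dots> = pf_list (\<lambda>i j. \<Sum>u\<in>{1..n}. \<Sum>v\<in>{1..n}. ?x u i * ?d u v * ?x v j) [0..<k]"
    by (rule pf_list_cong) (use entry in auto)
  also have "\<dots> = (\<Sum>g\<in>lists_of_length k {1..n}. pair_weight ?x g [0..<k] * pf_list ?d g)"
    using pf_list_congruence[of ?x ?d "{1..n}" "[0..<k]"] by simp
  also have "\<dots> = signed_row_sum n k ?x"
    unfolding signed_row_sum_def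
  proof (rule sum.cong[OF refl])
    fix g assume "g \<in> lists_of_length k {1..n}"
    then have g: "length g = k" by (simp add: lists_of_length_def)
    have "pair_weight ?x g [0..<k] = (\<Prod>b<k. ?x (g ! b) b)"
      using g by (simp add: pair_weight_def prod.list_conv_set_nth atLeast0LessThan)
    moreover have "pf_list ?d g = of_int ((-1) ^ sum_list g * order_sgn g)"
      by (rule pf_list_signs) (use g \<open>even k\<close> in simp)
    ultimately show "pair_weight ?x g [0..<k] * pf_list ?d g =
      of_int ((-1) ^ sum_list g * order_sgn g) * (\<Prod>b<k. ?x (g ! b) b)" by (simp add: mult_ac)
  qed
  finally show ?thesis .
qed

section \<open>Appending a column of ones and a row\<close>

text \<open>Induction on n. If n + 1 is not in A, the new summand is (-1)^(n+1). If it is, the new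
  summand vanishes and all earlier ones change sign, which reduces to A without n + 1.\<close>

lemma sum_alternating_pair_sgn:
  assumes "A \<subseteq> {1..n}"
  shows "(\<Sum>a = 1..n. (-1) ^ a * (\<Prod>y\<in>A. pair_sgn y a)) =
    (if even (card A) then (if even n then 0 else -1) else (if even n then 1 else 0))"
  using assms
proof (induction n arbitrary: A)
  case (Suc n)
  have fin: "finite A" using Suc.prems finite_subset by blast
  show ?case
  proof (cases "Suc n \<in> A")
    case False
    then have A: "A \<subseteq> {1..n}" using Suc.prems by (auto simp: subset_iff le_Suc_eq)
    have "(\<Prod>y\<in>A. pair_sgn y (Suc n)) = (\<Prod>y\<in>A. 1)"
      using A by (intro prod.cong) (force simp: pair_sgn_simps)+
    then show ?thesis using Suc.IH[OF A] by simp
  next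
    case True
    define B where "B = A - {Suc n}"
    have B: "B \<subseteq> {1..n}" using Suc.prems by (auto simp: B_def subset_iff le_Suc_eq)
    have A: "A = insert (Suc n) B" "Suc n \<notin> B" "finite B" using True fin by (auto simp: B_def)
    have "(\<Sum>a = 1..Suc n. (-1) ^ a * (\<Prod>y\<in>A. pair_sgn y a)) =
      - (\<Sum>a = 1..n. (-1) ^ a * (\<Prod>y\<in>B. pair_sgn y a))"
      using A by (auto simp: pair_sgn_simps simp flip: sum_negf intro!: sum.cong)
    then show ?thesis using Suc.IH[OF B] A by simp
  qed
qed simp

lemma order_sgn_snoc: "order_sgn (g @ [a]) = (\<Prod>y\<leftarrow>g. pair_sgn y a) * order_sgn g"
  by (induction g) (simp_all add: mult_ac)

lemma sum_order_sgn_snoc: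
  assumes "set g \<subseteq> {1..n}" "odd (length g)" "even n"
  shows "(\<Sum>a = 1..n. (-1) ^ a * order_sgn (g @ [a])) = order_sgn g"
proof (cases "distinct g")
  case True
  have "(\<Sum>a = 1..n. (-1) ^ a * order_sgn (g @ [a])) =
     (\<Sum>a = 1..n. (-1) ^ a * (\<Prod>y\<in>set g. pair_sgn y a)) * order_sgn g"
    using True unfolding order_sgn_snoc sum_distrib_right
    by (intro sum.cong) (simp_all add: prod.distinct_set_conv_list)
  then show ?thesis using sum_alternating_pair_sgn[OF assms(1)] assms True
    by (simp add: distinct_card)
qed (simp add: order_sgn_not_distinct)

text \<open>Splitting off the row a of the last column, whose entry is 1, leaves a sum over a of
  signs only, evaluated by \<open>sum_order_sgn_snoc\<close>.\<close>

lemma signed_row_sum_ones_col: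
  fixes x :: "nat \<Rightarrow> nat \<Rightarrow> 'a::comm_ring_1"
  assumes "odd k" "even n" and ones: "\<And>u. u \<in> {1..n} \<Longrightarrow> x u k = 1"
  shows "signed_row_sum n (Suc k) x = signed_row_sum n k x"
proof -
  have "signed_row_sum n (Suc k) x = (\<Sum>a = 1..n. \<Sum>g\<in>lists_of_length k {1..n}.
     of_int ((-1) ^ sum_list g * ((-1) ^ a * order_sgn (g @ [a]))) * (\<Prod>b<k. x (g ! b) b))"
    unfolding signed_row_sum_def sum_lists_of_length_insert[OF order_refl]
  proof (intro sum.cong refl)
    fix a g assume a: "a \<in> {1..n}" and "g \<in> lists_of_length k {1..n}"
    then have g: "length g = k" by (simp add: lists_of_length_def)
    have "(\<Prod>b<Suc k. x ((g @ [a]) ! b) b) = (\<Prod>b<k. x (g ! b) b)"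
      using g ones[OF a] by (auto simp: nth_append intro!: prod.cong)
    then show "of_int ((-1) ^ sum_list (take k g @ a # drop k g) * order_sgn (take k g @ a # drop k g)) *
       (\<Prod>b<Suc k. x ((take k g @ a # drop k g) ! b) b) =
       of_int ((-1) ^ sum_list g * ((-1) ^ a * order_sgn (g @ [a]))) * (\<Prod>b<k. x (g ! b) b)"
      using g by (simp add: power_add mult_ac)
  qed
  also have "\<dots> = (\<Sum>g\<in>lists_of_length k {1..n}. of_int ((-1) ^ sum_list g *
      (\<Sum>a = 1..n. (-1) ^ a * order_sgn (g @ [a]))) * (\<Prod>b<k. x (g ! b) b))"
    by (subst sum.swap) (simp add: sum_distrib_left sum_distrib_right)
  also have "\<dots> = signed_row_sum n k x"
    unfolding signed_row_sum_def
  proof (rule sum.cong[OF refl])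
    fix g assume "g \<in> lists_of_length k {1..n}"
    then have "set g \<subseteq> {1..n}" "odd (length g)" using \<open>odd k\<close> by (auto simp: lists_of_length_def)
    from sum_order_sgn_snoc[OF this \<open>even n\<close>]
    show "of_int ((-1) ^ sum_list g * (\<Sum>a = 1..n. (-1) ^ a * order_sgn (g @ [a]))) *
        (\<Prod>b<k. x (g ! b) b) =
      of_int ((-1) ^ sum_list g * order_sgn g) * (\<Prod>b<k. x (g ! b) b)" by simp
  qed
  finally show ?thesis .
qed

lemma signed_row_sum_zero_row:
  fixes x :: "nat \<Rightarrow> nat \<Rightarrow> 'a::comm_ring_1"
  assumes zero: "\<And>b. b < k \<Longrightarrow> x (Suc n) b = 0"
  shows "signed_row_sum (Suc n) k x = signed_row_sum n k x"
  unfolding signed_row_sum_def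
proof (rule sum.mono_neutral_right)
  show "\<forall>g\<in>lists_of_length k {1..Suc n} - lists_of_length k {1..n}.
    of_int ((-1) ^ sum_list g * order_sgn g) * (\<Prod>b<k. x (g ! b) b) = 0"
  proof
    fix g assume "g \<in> lists_of_length k {1..Suc n} - lists_of_length k {1..n}"
    then have "length g = k" "Suc n \<in> set g"
      by (auto simp: lists_of_length_def subset_iff le_Suc_eq)
    then obtain b where b: "b < k" "g ! b = Suc n" by (auto simp: in_set_conv_nth)
    then have "\<exists>b\<in>{..<k}. x (g ! b) b = 0"
      by (intro bexI[of _ b]) (simp_all add: zero)
    then have "(\<Prod>b<k. x (g ! b) b) = 0" by (intro prod_zero) auto
    then show "of_int ((-1) ^ sum_list g * order_sgn g) * (\<Prod>b<k. x (g ! b) b) = 0" by simp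
  qed
qed (simp add: finite_lists_of_length, force simp: lists_of_length_def)

lemma signed_row_sum_cong:
  assumes "\<And>u b. u \<in> {1..n} \<Longrightarrow> b < k \<Longrightarrow> x u b = y u b"
  shows "signed_row_sum n k x = signed_row_sum n k y"
  unfolding signed_row_sum_def
proof (intro sum.cong refl)
  fix g assume g: "g \<in> lists_of_length k {1..n}"
  have "(\<Prod>b<k. x (g ! b) b) = (\<Prod>b<k. y (g ! b) b)"
  proof (rule prod.cong[OF refl])
    fix b assume "b \<in> {..<k}"
    moreover from this g have "g ! b \<in> {1..n}"
      unfolding lists_of_length_def using nth_mem[of b g] by blast
    ultimately show "x (g ! b) b = y (g ! b) b" using assms by simp
  qed
  then show "of_int ((-1) ^ sum_list g * order_sgn g) * (\<Prod>b<k. x (g ! b) b) =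
    of_int ((-1) ^ sum_list g * order_sgn g) * (\<Prod>b<k. y (g ! b) b)" by simp
qed

section \<open>The three cases of the formula\<close>

lemma cullis_det_even:
  fixes X :: "'a::comm_ring_1 mat"
  assumes "X \<in> carrier_mat n k" "k \<le> n" "even k"
  shows "cullis_det X = (-1) ^ (\<Sum>{1..k}) * pfaffian (X\<^sup>T * D_mat n * X)"
  using assms by (simp add: cullis_det_eq_signed_row_sum pfaffian_eq_signed_row_sum)

lemma cullis_det_odd_even:
  fixes X :: "'a::comm_ring_1 mat"
  assumes X: "X \<in> carrier_mat n k" and "k \<le> n" "odd k" "even n"
  shows "cullis_det X = (-1) ^ (\<Sum>{1..k+1}) *
    pfaffian ((append_ones_col X)\<^sup>T * D_mat n * append_ones_col X)"
proof -
  let ?X' = "append_ones_col X"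
  have X': "?X' \<in> carrier_mat n (Suc k)" using X by (simp add: append_ones_col_def)
  have "pfaffian (?X'\<^sup>T * D_mat n * ?X') = signed_row_sum n (Suc k) (\<lambda>u b. ?X' $$ (u - 1, b))"
    using X' \<open>odd k\<close> by (simp add: pfaffian_eq_signed_row_sum)
  also have "\<dots> = signed_row_sum n k (\<lambda>u b. ?X' $$ (u - 1, b))"
    by (rule signed_row_sum_ones_col) (use assms in \<open>auto simp: append_ones_col_def\<close>)
  also have "\<dots> = signed_row_sum n k (\<lambda>u b. X $$ (u - 1, b))"
    by (rule signed_row_sum_cong) (use X in \<open>auto simp: append_ones_col_def\<close>)
  \<comment> \<open>The exponents of the outer signs differ by k + 1, which is even.\<close>
  finally show ?thesis
    using assms by (simp add: cullis_det_eq_signed_row_sum power_add)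
qed

lemma cullis_det_odd_odd:
  fixes X :: "'a::comm_ring_1 mat"
  assumes X: "X \<in> carrier_mat n k" and "k \<le> n" "odd k" "odd n"
  shows "cullis_det X = (-1) ^ (\<Sum>{1..k+1}) *
    pfaffian ((append_unit_row (append_ones_col X))\<^sup>T * D_mat (n+1) *
      append_unit_row (append_ones_col X))"
proof -
  let ?X'' = "append_unit_row (append_ones_col X)"
  let ?x = "\<lambda>u b. ?X'' $$ (u - 1, b)"
  have X'': "?X'' \<in> carrier_mat (Suc n) (Suc k)"
    using X by (simp add: append_ones_col_def append_unit_row_def)
  have "pfaffian (?X''\<^sup>T * D_mat (Suc n) * ?X'') = signed_row_sum (Suc n) (Suc k) ?x"
    using X'' \<open>odd k\<close> by (simp add: pfaffian_eq_signed_row_sum)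
  \<comment> \<open>The column is removed before the row: the last column consists of ones in the
    new row too, and the number n + 1 of rows is even.\<close>
  also have "\<dots> = signed_row_sum (Suc n) k ?x"
    by (rule signed_row_sum_ones_col)
      (use assms in \<open>auto simp: append_ones_col_def append_unit_row_def\<close>)
  \<comment> \<open>Within the first k columns the appended unit row is zero.\<close>
  also have "\<dots> = signed_row_sum n k ?x"
    by (rule signed_row_sum_zero_row) (use X in \<open>auto simp: append_ones_col_def append_unit_row_def\<close>)
  also have "\<dots> = signed_row_sum n k (\<lambda>u b. X $$ (u - 1, b))"
    by (rule signed_row_sum_cong) (use X in \<open>auto simp: append_ones_col_def append_unit_row_def\<close>)
  finally show ?thesis
    using assms by (simp add: cullis_det_eq_signed_row_sum power_add)
qed

text \<open>Stated for arbitrary matrices over a commutative ring, so that it covers both the matrix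
  of indeterminates and its transpose.\<close>

lemma cullis_det_eq_pfaffian:
  fixes X :: "'a::comm_ring_1 mat"
  assumes "X \<in> carrier_mat n k" "k \<le> n"
  shows "cullis_det X =
    (if even k then (-1) ^ (\<Sum>{1..k}) * pfaffian (X\<^sup>T * D_mat n * X)
     else if even n then
       (let X' = append_ones_col X in
        (-1) ^ (\<Sum>{1..k+1}) * pfaffian (X'\<^sup>T * D_mat n * X'))
     else
       (let X'' = append_unit_row (append_ones_col X) in
        (-1) ^ (\<Sum>{1..k+1}) * pfaffian (X''\<^sup>T * D_mat (n+1) * X'')))"
  unfolding Let_def
  using cullis_det_even[OF assms] cullis_det_odd_even[OF assms] cullis_det_odd_odd[OF assms]
  by (simp only: if_split) simp

theorem theorem1:
  fixes n k :: nat
    and X :: "(nat \<times> nat, 'a::field) polys mat"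
  assumes "n \<ge> 1" and "k \<ge> 1"
    and "X = indet_mat n k"
  shows "(n \<ge> k \<longrightarrow>
      cullis_det X =
        (if even k then
           (-1) ^ (\<Sum>{1..k}) * pfaffian (X\<^sup>T * D_mat n * X)
         else if even n then
           (let X' = append_ones_col X in
            (-1) ^ (\<Sum>{1..k+1}) * pfaffian (X'\<^sup>T * D_mat n * X'))
         else
           (let X'' = append_unit_row (append_ones_col X) in
            (-1) ^ (\<Sum>{1..k+1}) * pfaffian (X''\<^sup>T * D_mat (n+1) * X''))))
    \<and> (n < k \<longrightarrow>
      cullis_det X = cullis_det (X\<^sup>T) \<and>
      (let Z = X\<^sup>T in
       cullis_det Z =
        (if even n then
           (-1) ^ (\<Sum>{1..n}) * pfaffian (Z\<^sup>T * D_mat k * Z)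
         else if even k then
           (let Z' = append_ones_col Z in
            (-1) ^ (\<Sum>{1..n+1}) * pfaffian (Z'\<^sup>T * D_mat k * Z'))
         else
           (let Z'' = append_unit_row (append_ones_col Z) in
            (-1) ^ (\<Sum>{1..n+1}) * pfaffian (Z''\<^sup>T * D_mat (k+1) * Z'')))))"
proof -
  have X: "X \<in> carrier_mat n k" using assms(3) by (simp add: indet_mat_def)
  then have XT: "X\<^sup>T \<in> carrier_mat k n" by simp
  show ?thesis
  proof (intro conjI impI)
    assume "n < k"
    \<comment> \<open>The transpose has more rows than columns, so both sides unfold to
      \<open>cullis_det_tall\<close> of the transpose.\<close>
    then show "cullis_det X = cullis_det (X\<^sup>T)"
      using X by (simp add: cullis_det_def)
    show "let Z = X\<^sup>T in
       cullis_det Z =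
        (if even n then
           (-1) ^ (\<Sum>{1..n}) * pfaffian (Z\<^sup>T * D_mat k * Z)
         else if even k then
           (let Z' = append_ones_col Z in
            (-1) ^ (\<Sum>{1..n+1}) * pfaffian (Z'\<^sup>T * D_mat k * Z'))
         else
           (let Z'' = append_unit_row (append_ones_col Z) in
            (-1) ^ (\<Sum>{1..n+1}) * pfaffian (Z''\<^sup>T * D_mat (k+1) * Z'')))"
      unfolding Let_def[of "X\<^sup>T"] by (rule cullis_det_eq_pfaffian[OF XT less_imp_le]) fact
  qed (rule cullis_det_eq_pfaffian[OF X])
qed

end
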